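(* Let $\pi \in \Pi$, $\delta \in (0,1]$, $\lambda > 0$, and let $h:[0,1]^2\times[-1,0]\to(-\infty,0]$ satisfy $pc/q \le h(p,q,c) \le 0$ for all $(p,q,c)\in[0,1]^2\times[-1,0]$. Then, with probability at least $1-\delta$ over the logged data $\mathcal{D}_n$, $$R(\pi) \le \psi_\lambda\Big(-\frac1n\sum_{i=1}^n\frac1\lambda\log(1-\lambda h_i) + \frac{\ln(1/\delta)}{\lambda n}\Big).$$
   Context: Setting (offline contextual bandit). $\mathcal{X}\subset\mathbb{R}^d$ is a compact context space, $\mathcal{A}=\{1,\dots,K\}$ a finite action set, $\nu$ a probability distribution on $\mathcal{X}$. A policy $\pi$ assigns to each $x\in\mathcal{X}$ a probability distribution $\pi(\cdot|x)$ on $\mathcal{A}$; $\Pi$ is the set of policies and $\pi_0$ is a fixed behavior policy. Given $(x,a)$, a cost $c\in[-1,0]$ is drawn from a distribution $p(\cdot|x,a)$, with mean $c(x,a)$. The logged data $\mathcal{D}_n=(x_i,a_i,c_i)_{i\in[n]}$ consists of $n$ i.i.d. tuples with $x_i\sim\nu$, $a_i\sim\pi_0(\cdot|x_i)$, $c_i\sim p(\cdot|x_i,a_i)$ (so $\pi_0(a_i|x_i)>0$ almost surely). The risk of a policy is $R(\pi)=\mathbb{E}_{x\sim\nu,\,a\sim\pi(\cdot|x)}[c(x,a)]$. Notation. $h_i = h(\pi(a_i|x_i),\pi_0(a_i|x_i),c_i)$; $\psi_\lambda(x)=\frac1\lambda(1-e^{-\lambda x})$ for $x\in\mathbb{R}$.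 (The functions $h$ are understood to be measurable, and the condition on $h$ is only relevant for $q>0$.) *)

theory Defs
  imports "HOL-Probability.Probability"
begin

definition context_space :: "(real ^ 'd) set \<Rightarrow> (real ^ 'd) measure" where
  "context_space X = restrict_space borel X"

definition action_space :: "nat \<Rightarrow> nat measure" where
  "action_space K = count_space {1..K}"

definition cost_space :: "real measure" where
  "cost_space = restrict_space borel {-1..0}"

text \<open>Policies and cost distributions are probability kernels, i.e. measurable maps into
  \<^const>\<open>prob_algebra\<close>. Only their values on the respective spaces matter.\<close>

definition policies :: "(real ^ 'd) set \<Rightarrow> nat \<Rightarrow> (real ^ 'd \<Rightarrow> nat measure) set" where
  "policies X K = context_space X \<rightarrow>\<^sub>M prob_algebra (action_space K)"

definition cost_kernels ::
    "(real ^ 'd) set \<Rightarrow> nat \<Rightarrow> ((real ^ 'd) \<times> nat \<Rightarrow> real measure) set" where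
  "cost_kernels X K = (context_space X \<Otimes>\<^sub>M action_space K) \<rightarrow>\<^sub>M prob_algebra cost_space"

definition policy_prob :: "(real ^ 'd \<Rightarrow> nat measure) \<Rightarrow> nat \<Rightarrow> real ^ 'd \<Rightarrow> real" where
  "policy_prob \<pi> a x = measure (\<pi> x) {a}"

definition mean_cost :: "((real ^ 'd) \<times> nat \<Rightarrow> real measure) \<Rightarrow> real ^ 'd \<Rightarrow> nat \<Rightarrow> real" where
  "mean_cost p x a = (\<integral>c. c \<partial>p (x, a))"

definition context_action_dist ::
    "(real ^ 'd) set \<Rightarrow> nat \<Rightarrow> (real ^ 'd) measure \<Rightarrow> (real ^ 'd \<Rightarrow> nat measure)
      \<Rightarrow> ((real ^ 'd) \<times> nat) measure" where
  "context_action_dist X K \<nu> \<pi> =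
     \<nu> \<bind> (\<lambda>x. \<pi> x \<bind> (\<lambda>a. return (context_space X \<Otimes>\<^sub>M action_space K) (x, a)))"

definition risk ::
    "(real ^ 'd) set \<Rightarrow> nat \<Rightarrow> (real ^ 'd) measure \<Rightarrow> ((real ^ 'd) \<times> nat \<Rightarrow> real measure)
      \<Rightarrow> (real ^ 'd \<Rightarrow> nat measure) \<Rightarrow> real" where
  "risk X K \<nu> p \<pi> = (\<integral>(x, a). mean_cost p x a \<partial>context_action_dist X K \<nu> \<pi>)"

definition logged_tuple_dist ::
    "(real ^ 'd) set \<Rightarrow> nat \<Rightarrow> (real ^ 'd) measure \<Rightarrow> ((real ^ 'd) \<times> nat \<Rightarrow> real measure)
      \<Rightarrow> (real ^ 'd \<Rightarrow> nat measure) \<Rightarrow> ((real ^ 'd) \<times> nat \<times> real) measure" where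
  "logged_tuple_dist X K \<nu> p \<pi>\<^sub>0 =
     \<nu> \<bind> (\<lambda>x. \<pi>\<^sub>0 x \<bind> (\<lambda>a. p (x, a) \<bind> (\<lambda>c.
       return (context_space X \<Otimes>\<^sub>M action_space K \<Otimes>\<^sub>M cost_space) (x, a, c))))"

definition logged_data_dist ::
    "(real ^ 'd) set \<Rightarrow> nat \<Rightarrow> (real ^ 'd) measure \<Rightarrow> ((real ^ 'd) \<times> nat \<Rightarrow> real measure)
      \<Rightarrow> (real ^ 'd \<Rightarrow> nat measure) \<Rightarrow> nat \<Rightarrow> (nat \<Rightarrow> (real ^ 'd) \<times> nat \<times> real) measure" where
  "logged_data_dist X K \<nu> p \<pi>\<^sub>0 n = (\<Pi>\<^sub>M i\<in>{1..n}. logged_tuple_dist X K \<nu> p \<pi>\<^sub>0)"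

definition regularized_cost ::
    "(real \<Rightarrow> real \<Rightarrow> real \<Rightarrow> real) \<Rightarrow> (real ^ 'd \<Rightarrow> nat measure) \<Rightarrow> (real ^ 'd \<Rightarrow> nat measure)
      \<Rightarrow> (real ^ 'd) \<times> nat \<times> real \<Rightarrow> real" where
  "regularized_cost h \<pi> \<pi>\<^sub>0 = (\<lambda>(x, a, c). h (policy_prob \<pi> a x) (policy_prob \<pi>\<^sub>0 a x) c)"

definition psi :: "real \<Rightarrow> real \<Rightarrow> real" where
  "psi lam x = (1 / lam) * (1 - exp (- lam * x))"

end

theory Submission
  imports Defs
begin

text \<open>Put \<open>Y = 1 - lam * h\<close>, so that \<open>Y \<ge> 1\<close>. Importance weighting turns the lower bound on \<open>h\<close>
  into \<open>E Y \<le> 1 - lam * R(\<pi>)\<close>; actions that \<open>\<pi>\<^sub>0\<close> never plays only help, because costs are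
  nonpositive. By independence \<open>E (\<Prod>i. Y i) \<le> (1 - lam * R(\<pi>)) ^ n\<close>, and Markov's inequality
  bounds \<open>\<Prod>i. Y i\<close> by \<open>(1 - lam * R(\<pi>)) ^ n / \<delta>\<close> with probability at least \<open>1 - \<delta>\<close>. Taking
  logarithms and solving for \<open>R(\<pi>)\<close> gives the bound.\<close>

section \<open>Markov's inequality for a product of independent copies\<close>

text \<open>Under a product measure, the integral of a product of nonnegative functions of separate
  coordinates factorizes. Stating \<open>mean\<close> as a nonnegative integral keeps this free of
  integrability side conditions, and Markov's inequality asks for no more than an upper bound on the
  mean.\<close>

lemma (in prob_space) measure_PiM_prod_le:
  fixes Y :: "'a \<Rightarrow> real" and I :: "'i set"
  assumes I: "finite I"
    and Y[measurable]: "Y \<in> borel_measurable M"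
    and Y_nonneg: "\<And>x. x \<in> space M \<Longrightarrow> 0 \<le> Y x"
    and mean: "(\<integral>\<^sup>+x. ennreal (Y x) \<partial>M) \<le> ennreal m"
    and "0 < m" and "0 < \<delta>"
  shows "measure (\<Pi>\<^sub>M i\<in>I. M) {D \<in> space (\<Pi>\<^sub>M i\<in>I. M). (\<Prod>i\<in>I. Y (D i)) \<le> m ^ card I / \<delta>} \<ge> 1 - \<delta>"
proof -
  let ?P = "\<Pi>\<^sub>M i\<in>I. M"
  let ?good = "{D \<in> space ?P. (\<Prod>i\<in>I. Y (D i)) \<le> m ^ card I / \<delta>}"
  interpret P: prob_space ?P
    by (intro prob_space_PiM prob_space_axioms)
  interpret S: product_sigma_finite "\<lambda>_::'i. M"
    by unfold_locales
  \<comment> \<open>The reciprocal of the threshold \<open>m ^ card I / \<delta>\<close>: the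
    library form of Markov's inequality bounds the event where 1 is at most c times the
    function.\<close>
  define c where "c = \<delta> / m ^ card I"
  have c: "0 < c" using assms by (simp add: c_def)
  have good[measurable]: "?good \<in> sets ?P" by measurable
  have "(\<integral>\<^sup>+D. ennreal (\<Prod>i\<in>I. Y (D i)) \<partial>?P) = (\<integral>\<^sup>+D. (\<Prod>i\<in>I. ennreal (Y (D i))) \<partial>?P)"
    by (intro nn_integral_cong) (auto simp: space_PiM PiE_mem intro!: prod_ennreal[symmetric] Y_nonneg)
  also have "\<dots> = (\<Prod>i\<in>I. \<integral>\<^sup>+x. ennreal (Y x) \<partial>M)"
    by (intro S.product_nn_integral_prod I) simp
  also have "\<dots> \<le> (\<Prod>i\<in>I. ennreal m)"
    by (intro prod_mono_ennreal mean)
  also have "\<dots> = ennreal (m ^ card I)"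
    using \<open>0 < m\<close> by (simp add: ennreal_power)
  finally have prod_mean: "(\<integral>\<^sup>+D. ennreal (\<Prod>i\<in>I. Y (D i)) \<partial>?P) \<le> ennreal (m ^ card I)" .
  \<comment> \<open>The estimate is made for the complement: exceeding the threshold strictly
    implies the weak inequality of the Markov event.\<close>
  have "emeasure ?P (space ?P - ?good)
      \<le> emeasure ?P {D \<in> space ?P. 1 \<le> ennreal c * ennreal (\<Prod>i\<in>I. Y (D i))}"
  proof (intro emeasure_mono)
    show "space ?P - ?good \<subseteq> {D \<in> space ?P. 1 \<le> ennreal c * ennreal (\<Prod>i\<in>I. Y (D i))}"
    proof safe
      fix D assume "D \<in> space ?P" and "\<not> (\<Prod>i\<in>I. Y (D i)) \<le> m ^ card I / \<delta>"
      then have "1 \<le> c * (\<Prod>i\<in>I. Y (D i))"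
        using \<open>0 < m\<close> \<open>0 < \<delta>\<close> by (simp add: c_def field_simps)
      then have "ennreal 1 \<le> ennreal (c * (\<Prod>i\<in>I. Y (D i)))"
        by (intro ennreal_leI)
      then show "1 \<le> ennreal c * ennreal (\<Prod>i\<in>I. Y (D i))"
        using c by (simp add: ennreal_mult')
    qed
  qed measurable
  also have "\<dots> \<le> ennreal c * (\<integral>\<^sup>+D. ennreal (\<Prod>i\<in>I. Y (D i)) * indicator (space ?P) D \<partial>?P)"
    by (intro nn_integral_Markov_inequality) auto
  also have "\<dots> = ennreal c * (\<integral>\<^sup>+D. ennreal (\<Prod>i\<in>I. Y (D i)) \<partial>?P)"
    by (intro arg_cong2[where f="(*)"] nn_integral_cong refl) simp
  also have "\<dots> \<le> ennreal c * ennreal (m ^ card I)"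
    by (intro mult_left_mono prod_mean) simp
  also have "\<dots> = ennreal \<delta>"
    using c \<open>0 < m\<close> by (simp add: c_def flip: ennreal_mult')
  finally have "measure ?P (space ?P - ?good) \<le> \<delta>"
    using \<open>0 < \<delta>\<close> by (simp add: P.emeasure_eq_measure)
  then show ?thesis
    using P.prob_compl[OF good] by simp
qed

section \<open>Integrals over finite action sets and basic facts on kernels\<close>

lemma nn_integral_finite_count_space:
  assumes "sets M = sets (count_space A)" and "finite A"
  shows "(\<integral>\<^sup>+a. f a \<partial>M) = (\<Sum>a\<in>A. f a * emeasure M {a})"
proof -
  have "(\<integral>\<^sup>+a. f a \<partial>M) = (\<integral>\<^sup>+a. f a * indicator A a \<partial>M)"
    using sets_eq_imp_space_eq[OF assms(1)] by (intro nn_integral_cong) simp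
  also have "\<dots> = (\<Sum>a\<in>A. f a * emeasure M {a})"
    using assms by (intro nn_integral_indicator_finite) auto
  finally show ?thesis .
qed

lemma space_context_space[simp]: "space (context_space X) = X"
  by (simp add: context_space_def space_restrict_space)

lemma space_action_space[simp]: "space (action_space K) = {1..K}"
  by (simp add: action_space_def)

lemma space_cost_space[simp]: "space cost_space = {-1..0}"
  by (simp add: cost_space_def space_restrict_space)

lemma borel_measurable_cost_space: "(\<lambda>c. c) \<in> borel_measurable cost_space"
  unfolding cost_space_def by (intro measurable_restrict_space1) simp

lemma kernel_prob_space:
  assumes "k \<in> M \<rightarrow>\<^sub>M prob_algebra N" and "x \<in> space M"
  shows "prob_space (k x)" and "sets (k x) = sets N" and "space (k x) = space N"
proof -
  have "k x \<in> space (prob_algebra N)"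
    using measurable_space[OF assms] .
  then show "prob_space (k x)" and "sets (k x) = sets N"
    by (auto simp: space_prob_algebra)
  then show "space (k x) = space N"
    by (intro sets_eq_imp_space_eq)
qed

text \<open>Closure under bind is read off from measurability:
  \<open>measurable_bind_prob_space\<close>, applied to the identity family of measures, gives a
  measurable map into \<open>prob_algebra B\<close>, which is then evaluated at
  \<open>M\<close>.\<close>

lemma bind_in_prob_algebra:
  assumes M: "M \<in> space (prob_algebra A)" and k: "k \<in> A \<rightarrow>\<^sub>M prob_algebra B"
  shows "M \<bind> k \<in> space (prob_algebra B)"
proof -
  have "(\<lambda>M. M \<bind> k) \<in> prob_algebra A \<rightarrow>\<^sub>M prob_algebra B"
    by (rule measurable_bind_prob_space[OF _ k]) simp
  from measurable_space[OF this M] show ?thesis .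
qed

lemma policy_prob_measurable:
  assumes "\<pi> \<in> policies X K" and "a \<in> {1..K}"
  shows "policy_prob \<pi> a \<in> borel_measurable (context_space X)"
  unfolding policy_prob_def
  by (rule measurable_compose[OF assms(1)[unfolded policies_def]
        measurable_measure_prob_algebra[where A="action_space K"]])
     (use assms(2) in \<open>simp add: action_space_def\<close>)

lemma policy_prob_bounds:
  assumes "\<pi> \<in> policies X K" and "x \<in> X"
  shows "policy_prob \<pi> a x \<in> {0..1}"
proof -
  interpret prob_space "\<pi> x"
    using assms by (intro kernel_prob_space[where M="context_space X"]) (auto simp: policies_def)
  show ?thesis by (simp add: policy_prob_def)
qed

lemma emeasure_policy:
  assumes "\<pi> \<in> policies X K" and "x \<in> X"
  shows "emeasure (\<pi> x) {a} = ennreal (policy_prob \<pi> a x)"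
proof -
  interpret prob_space "\<pi> x"
    using assms by (intro kernel_prob_space[where M="context_space X"]) (auto simp: policies_def)
  show ?thesis by (simp add: policy_prob_def emeasure_eq_measure)
qed

lemma sum_policy_prob:
  assumes "\<pi> \<in> policies X K" and "x \<in> X"
  shows "(\<Sum>a=1..K. policy_prob \<pi> a x) = 1"
proof -
  have \<pi>: "\<pi> \<in> context_space X \<rightarrow>\<^sub>M prob_algebra (action_space K)"
    using assms by (simp add: policies_def)
  interpret prob_space "\<pi> x"
    using assms by (intro kernel_prob_space(1)[OF \<pi>]) simp
  have "space (\<pi> x) = {1..K}" "sets (\<pi> x) = Pow {1..K}"
    using assms kernel_prob_space(2,3)[OF \<pi>] by (auto simp: action_space_def)
  then show ?thesis
    using prob_space finite_measure_eq_sum_singleton[of "{1..K}"]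
    by (auto simp: policy_prob_def)
qed

text \<open>Writing the integrals under both policies as finite sums over the same actions is what
  later allows a comparison action by action.\<close>

lemma nn_integral_policy:
  assumes "\<pi> \<in> policies X K" and "x \<in> X"
  shows "(\<integral>\<^sup>+a. f a \<partial>\<pi> x) = (\<Sum>a=1..K. f a * ennreal (policy_prob \<pi> a x))"
proof -
  have \<pi>: "\<pi> \<in> context_space X \<rightarrow>\<^sub>M prob_algebra (action_space K)"
    using assms by (simp add: policies_def)
  show ?thesis
    using kernel_prob_space(2)[OF \<pi>] assms
    by (subst nn_integral_finite_count_space[where A="{1..K}"])
       (auto simp: action_space_def emeasure_policy)
qed

section \<open>Mean cost of a context-action pair\<close>

lemma
  assumes "p \<in> cost_kernels X K" and "x \<in> X" and "a \<in> {1..K}"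
  shows mean_cost_bounds: "mean_cost p x a \<in> {-1..0}"
    and integrable_cost: "integrable (p (x, a)) (\<lambda>c. c)"
proof -
  have p: "p \<in> (context_space X \<Otimes>\<^sub>M action_space K) \<rightarrow>\<^sub>M prob_algebra cost_space"
    using assms by (simp add: cost_kernels_def)
  have xa: "(x, a) \<in> space (context_space X \<Otimes>\<^sub>M action_space K)"
    using assms by (simp add: space_pair_measure)
  interpret prob_space "p (x, a)"
    by (rule kernel_prob_space(1)[OF p xa])
  have sp: "space (p (x, a)) = {-1..0}"
    using kernel_prob_space(3)[OF p xa] by simp
  have "(\<lambda>c. c) \<in> borel_measurable (p (x, a))"
    using borel_measurable_cost_space kernel_prob_space(2)[OF p xa]
    by (simp cong: measurable_cong_sets)
  then show int: "integrable (p (x, a)) (\<lambda>c. c)"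
    by (intro integrable_const_bound[where B=1]) (auto simp: sp)
  show "mean_cost p x a \<in> {-1..0}"
    using integral_ge_const[OF int AE_I2, of "-1"] integral_le_const[OF int AE_I2, of 0]
    by (simp add: mean_cost_def sp)
qed

text \<open>Integrating a fixed measurable function is itself a measurable map on
  \<open>subprob_algebra cost_space\<close>; the mean cost is its composition with the kernel
  \<open>p\<close>.\<close>

lemma mean_cost_measurable:
  assumes "p \<in> cost_kernels X K"
  shows "(\<lambda>(x, a). mean_cost p x a) \<in> borel_measurable (context_space X \<Otimes>\<^sub>M action_space K)"
proof -
  have "p \<in> (context_space X \<Otimes>\<^sub>M action_space K) \<rightarrow>\<^sub>M subprob_algebra cost_space"
    using assms by (simp add: cost_kernels_def measurable_prob_algebraD)
  from measurable_compose[OF this integral_measurable_subprob_algebra[OF borel_measurable_cost_space]]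
  show ?thesis
    by (simp add: mean_cost_def case_prod_unfold)
qed

section \<open>The context-action and logged-tuple laws as iterated integrals\<close>

lemma context_action_kernel:
  assumes "\<pi> \<in> policies X K"
  shows "(\<lambda>x. \<pi> x \<bind> (\<lambda>a. return (context_space X \<Otimes>\<^sub>M action_space K) (x, a)))
    \<in> context_space X \<rightarrow>\<^sub>M prob_algebra (context_space X \<Otimes>\<^sub>M action_space K)"
proof -
  have [measurable]: "\<pi> \<in> context_space X \<rightarrow>\<^sub>M prob_algebra (action_space K)"
    using assms by (simp add: policies_def)
  show ?thesis by measurable
qed

text \<open>Each claim licenses the removal of one bind under an integral: the first that over
  contexts, the second, at a fixed context, that over actions.\<close>

lemma logged_tuple_kernel:
  assumes "\<pi>\<^sub>0 \<in> policies X K" and "p \<in> cost_kernels X K"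
  shows "(\<lambda>x. \<pi>\<^sub>0 x \<bind> (\<lambda>a. p (x, a) \<bind> (\<lambda>c.
       return (context_space X \<Otimes>\<^sub>M action_space K \<Otimes>\<^sub>M cost_space) (x, a, c))))
    \<in> context_space X \<rightarrow>\<^sub>M prob_algebra (context_space X \<Otimes>\<^sub>M action_space K \<Otimes>\<^sub>M cost_space)"
    (is ?thesis1)
  and "x \<in> X \<Longrightarrow> (\<lambda>a. p (x, a) \<bind> (\<lambda>c.
       return (context_space X \<Otimes>\<^sub>M action_space K \<Otimes>\<^sub>M cost_space) (x, a, c)))
    \<in> action_space K \<rightarrow>\<^sub>M prob_algebra (context_space X \<Otimes>\<^sub>M action_space K \<Otimes>\<^sub>M cost_space)"
    (is "_ \<Longrightarrow> ?thesis2")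
proof -
  have [measurable]: "\<pi>\<^sub>0 \<in> context_space X \<rightarrow>\<^sub>M prob_algebra (action_space K)"
    "p \<in> (context_space X \<Otimes>\<^sub>M action_space K) \<rightarrow>\<^sub>M prob_algebra cost_space"
    using assms by (simp_all add: policies_def cost_kernels_def)
  show ?thesis1 by measurable
  assume x: "x \<in> X"
  show ?thesis2
  proof (rule measurable_bind_prob_space2)
    show "(\<lambda>a. p (x, a)) \<in> action_space K \<rightarrow>\<^sub>M prob_algebra cost_space"
      using x assms(2)
      by (intro measurable_compose[OF measurable_Pair1'[where ?M1.0="context_space X"]])
         (auto simp: cost_kernels_def)
    have "(\<lambda>z. (x, fst z, snd z)) \<in> action_space K \<Otimes>\<^sub>M cost_space
        \<rightarrow>\<^sub>M context_space X \<Otimes>\<^sub>M action_space K \<Otimes>\<^sub>M cost_space"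
      using x by (intro measurable_Pair measurable_const measurable_fst measurable_snd) auto
    from measurable_compose[OF this measurable_return_prob_space]
    show "(\<lambda>(a, c). return (context_space X \<Otimes>\<^sub>M action_space K \<Otimes>\<^sub>M cost_space) (x, a, c))
      \<in> action_space K \<Otimes>\<^sub>M cost_space
        \<rightarrow>\<^sub>M prob_algebra (context_space X \<Otimes>\<^sub>M action_space K \<Otimes>\<^sub>M cost_space)"
      by (simp add: case_prod_unfold)
  qed
qed

text \<open>Costs are nonpositive, so after negation the risk is a nonnegative integral and the
  binds of \<open>context_action_dist\<close> unfold without integrability conditions. This is the
  form that the importance-weighted bound is matched against.\<close>

lemma
  fixes X :: "(real ^ 'd) set"
  assumes \<nu>: "\<nu> \<in> space (prob_algebra (context_space X))"
    and p: "p \<in> cost_kernels X K"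
    and \<pi>: "\<pi> \<in> policies X K"
  shows risk_nonpos: "risk X K \<nu> p \<pi> \<le> 0"
    and nn_integral_mean_cost_eq_risk: "(\<integral>\<^sup>+x. \<integral>\<^sup>+a. ennreal (- mean_cost p x a) \<partial>\<pi> x \<partial>\<nu>) = ennreal (- risk X K \<nu> p \<pi>)"
proof -
  let ?B = "context_space X \<Otimes>\<^sub>M action_space K"
  let ?C = "context_action_dist X K \<nu> \<pi>"
  have sets_\<nu>: "sets \<nu> = sets (context_space X)"
    using \<nu> by (simp add: space_prob_algebra)
  have sp_\<nu>: "space \<nu> = X"
    using sets_eq_imp_space_eq[OF sets_\<nu>] by simp
  have kern: "(\<lambda>x. \<pi> x \<bind> (\<lambda>a. return ?B (x, a))) \<in> \<nu> \<rightarrow>\<^sub>M prob_algebra ?B"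
    using context_action_kernel[OF \<pi>] sets_\<nu> by (simp cong: measurable_cong_sets)
  have \<pi>': "\<pi> \<in> context_space X \<rightarrow>\<^sub>M prob_algebra (action_space K)"
    using \<pi> by (simp add: policies_def)
  note [measurable] = mean_cost_measurable[OF p]
  have "?C \<in> space (prob_algebra ?B)"
    unfolding context_action_dist_def
    by (rule bind_in_prob_algebra[OF \<nu> context_action_kernel[OF \<pi>]])
  then interpret C: prob_space ?C
    by (simp add: space_prob_algebra)
  have sets_C: "sets ?C = sets ?B"
    using \<open>?C \<in> space (prob_algebra ?B)\<close> by (simp add: space_prob_algebra)
  have sp_C: "space ?C = X \<times> {1..K}"
    using sets_eq_imp_space_eq[OF sets_C] by (simp add: space_pair_measure)
  have bounds: "mean_cost p x a \<in> {-1..0}" if "x \<in> X" "a \<in> {1..K}" for x a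
    using mean_cost_bounds[OF p that] .
  have "(\<lambda>(x, a). mean_cost p x a) \<in> borel_measurable ?C"
    using mean_cost_measurable[OF p] sets_C by (simp cong: measurable_cong_sets)
  then have int: "integrable ?C (\<lambda>(x, a). mean_cost p x a)"
    using bounds by (intro C.integrable_const_bound[where B=1] AE_I2) (force simp: sp_C abs_le_iff)+
  show "risk X K \<nu> p \<pi> \<le> 0"
    unfolding risk_def using bounds
    by (intro C.integral_le_const int AE_I2) (auto simp: sp_C)
  \<comment> \<open>Since \<open>ennreal\<close> sends negative reals to 0, this passage is lossless
    only because \<open>bounds\<close> makes the negated mean cost nonnegative; \<open>int\<close>
    connects it with the Bochner integral in \<open>risk\<close>.\<close>
  have "ennreal (- risk X K \<nu> p \<pi>) = (\<integral>\<^sup>+z. ennreal (- (case z of (x, a) \<Rightarrow> mean_cost p x a)) \<partial>?C)"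
    unfolding risk_def using bounds int
    by (subst nn_integral_eq_integral) (auto simp: sp_C intro!: AE_I2)
  also have "\<dots> = (\<integral>\<^sup>+x. \<integral>\<^sup>+z. ennreal (- (case z of (x, a) \<Rightarrow> mean_cost p x a))
      \<partial>(\<pi> x \<bind> (\<lambda>a. return ?B (x, a))) \<partial>\<nu>)"
    unfolding context_action_dist_def
    by (rule nn_integral_bind[where B="?B", OF _ measurable_prob_algebraD[OF kern]]) measurable
  also have "\<dots> = (\<integral>\<^sup>+x. \<integral>\<^sup>+a. ennreal (- mean_cost p x a) \<partial>\<pi> x \<partial>\<nu>)"
  proof (intro nn_integral_cong)
    fix x assume "x \<in> space \<nu>"
    then have x: "x \<in> X" by (simp add: sp_\<nu>)
    then have [measurable]: "(\<lambda>a. (x, a)) \<in> \<pi> x \<rightarrow>\<^sub>M ?B"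
      using kernel_prob_space(2)[OF \<pi>', of x] by (simp cong: measurable_cong_sets)
    have "(\<integral>\<^sup>+z. ennreal (- (case z of (x, a) \<Rightarrow> mean_cost p x a)) \<partial>(\<pi> x \<bind> (\<lambda>a. return ?B (x, a))))
      = (\<integral>\<^sup>+a. \<integral>\<^sup>+z. ennreal (- (case z of (x, a) \<Rightarrow> mean_cost p x a)) \<partial>return ?B (x, a) \<partial>\<pi> x)"
      by (rule nn_integral_bind[where B="?B"]) measurable
    also have "\<dots> = (\<integral>\<^sup>+a. ennreal (- mean_cost p x a) \<partial>\<pi> x)"
      using x kernel_prob_space(3)[OF \<pi>', of x]
      by (intro nn_integral_cong) (subst nn_integral_return, auto simp: space_pair_measure)
    finally show "(\<integral>\<^sup>+z. ennreal (- (case z of (x, a) \<Rightarrow> mean_cost p x a)) \<partial>(\<pi> x \<bind> (\<lambda>a. return ?B (x, a))))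
      = (\<integral>\<^sup>+a. ennreal (- mean_cost p x a) \<partial>\<pi> x)" .
  qed
  finally show "(\<integral>\<^sup>+x. \<integral>\<^sup>+a. ennreal (- mean_cost p x a) \<partial>\<pi> x \<partial>\<nu>) = ennreal (- risk X K \<nu> p \<pi>)" ..
qed

lemma logged_tuple_dist:
  assumes \<nu>: "\<nu> \<in> space (prob_algebra (context_space X))"
    and p: "p \<in> cost_kernels X K"
    and \<pi>\<^sub>0: "\<pi>\<^sub>0 \<in> policies X K"
  shows "logged_tuple_dist X K \<nu> p \<pi>\<^sub>0
    \<in> space (prob_algebra (context_space X \<Otimes>\<^sub>M action_space K \<Otimes>\<^sub>M cost_space))"
  unfolding logged_tuple_dist_def
  by (rule bind_in_prob_algebra[OF \<nu> logged_tuple_kernel(1)[OF \<pi>\<^sub>0 p]])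

text \<open>The binds are removed from the inside out: \<open>inner\<close> treats the cost at a
  fixed context and action, \<open>middle\<close> the action at a fixed context, and the last step
  the context.\<close>

lemma nn_integral_logged_tuple_dist:
  fixes f :: "(real ^ 'd) \<times> nat \<times> real \<Rightarrow> ennreal"
  assumes \<nu>: "\<nu> \<in> space (prob_algebra (context_space X))"
    and p: "p \<in> cost_kernels X K"
    and \<pi>\<^sub>0: "\<pi>\<^sub>0 \<in> policies X K"
    and f[measurable]: "f \<in> borel_measurable (context_space X \<Otimes>\<^sub>M action_space K \<Otimes>\<^sub>M cost_space)"
  shows "(\<integral>\<^sup>+z. f z \<partial>logged_tuple_dist X K \<nu> p \<pi>\<^sub>0)
    = (\<integral>\<^sup>+x. \<integral>\<^sup>+a. \<integral>\<^sup>+c. f (x, a, c) \<partial>p (x, a) \<partial>\<pi>\<^sub>0 x \<partial>\<nu>)"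
proof -
  let ?B = "context_space X \<Otimes>\<^sub>M action_space K \<Otimes>\<^sub>M cost_space"
  let ?p = "\<lambda>x a. p (x, a) \<bind> (\<lambda>c. return ?B (x, a, c))"
  have sets_\<nu>: "sets \<nu> = sets (context_space X)"
    using \<nu> by (simp add: space_prob_algebra)
  have sp_\<nu>: "space \<nu> = X"
    using sets_eq_imp_space_eq[OF sets_\<nu>] by simp
  have \<pi>\<^sub>0': "\<pi>\<^sub>0 \<in> context_space X \<rightarrow>\<^sub>M prob_algebra (action_space K)"
    using \<pi>\<^sub>0 by (simp add: policies_def)
  have p': "p \<in> (context_space X \<Otimes>\<^sub>M action_space K) \<rightarrow>\<^sub>M prob_algebra cost_space"
    using p by (simp add: cost_kernels_def)
  have kern: "(\<lambda>x. \<pi>\<^sub>0 x \<bind> ?p x) \<in> \<nu> \<rightarrow>\<^sub>M subprob_algebra ?B"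
    using measurable_prob_algebraD[OF logged_tuple_kernel(1)[OF \<pi>\<^sub>0 p]] sets_\<nu>
    by (simp cong: measurable_cong_sets)
  have inner: "(\<integral>\<^sup>+z. f z \<partial>?p x a) = (\<integral>\<^sup>+c. f (x, a, c) \<partial>p (x, a))"
    if x: "x \<in> X" and a: "a \<in> {1..K}" for x a
  proof -
    have xa: "(x, a) \<in> space (context_space X \<Otimes>\<^sub>M action_space K)"
      using x a by (simp add: space_pair_measure)
    have "(\<lambda>c. (x, a, c)) \<in> cost_space \<rightarrow>\<^sub>M ?B"
      using x a by (intro measurable_Pair measurable_const measurable_ident) auto
    \<comment> \<open>The bind is taken over \<open>p (x, a)\<close> itself, so measurability is
      transferred to it from \<open>cost_space\<close>, which has the same measurable sets.\<close>
    then have [measurable]: "(\<lambda>c. (x, a, c)) \<in> p (x, a) \<rightarrow>\<^sub>M ?B"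
      using kernel_prob_space(2)[OF p' xa] by (simp cong: measurable_cong_sets)
    have "(\<integral>\<^sup>+z. f z \<partial>?p x a) = (\<integral>\<^sup>+c. \<integral>\<^sup>+z. f z \<partial>return ?B (x, a, c) \<partial>p (x, a))"
      by (rule nn_integral_bind[where B="?B"]) measurable
    also have "\<dots> = (\<integral>\<^sup>+c. f (x, a, c) \<partial>p (x, a))"
      using x a kernel_prob_space(3)[OF p' xa]
      by (intro nn_integral_cong nn_integral_return) (auto simp: space_pair_measure)
    finally show ?thesis .
  qed
  have middle: "(\<integral>\<^sup>+z. f z \<partial>(\<pi>\<^sub>0 x \<bind> ?p x)) = (\<integral>\<^sup>+a. \<integral>\<^sup>+c. f (x, a, c) \<partial>p (x, a) \<partial>\<pi>\<^sub>0 x)"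
    if x: "x \<in> X" for x
  proof -
    have "?p x \<in> \<pi>\<^sub>0 x \<rightarrow>\<^sub>M subprob_algebra ?B"
      using measurable_prob_algebraD[OF logged_tuple_kernel(2)[OF \<pi>\<^sub>0 p x]] x
        kernel_prob_space(2)[OF \<pi>\<^sub>0', of x]
      by (simp cong: measurable_cong_sets)
    then have "(\<integral>\<^sup>+z. f z \<partial>(\<pi>\<^sub>0 x \<bind> ?p x)) = (\<integral>\<^sup>+a. \<integral>\<^sup>+z. f z \<partial>?p x a \<partial>\<pi>\<^sub>0 x)"
      by (rule nn_integral_bind[OF f])
    also have "\<dots> = (\<integral>\<^sup>+a. \<integral>\<^sup>+c. f (x, a, c) \<partial>p (x, a) \<partial>\<pi>\<^sub>0 x)"
      using kernel_prob_space(3)[OF \<pi>\<^sub>0', of x] x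
      by (intro nn_integral_cong inner) auto
    finally show ?thesis .
  qed
  show ?thesis
    unfolding logged_tuple_dist_def nn_integral_bind[OF f kern]
    by (intro nn_integral_cong middle) (simp add: sp_\<nu>)
qed

section \<open>Measurability and mean of the regularized cost\<close>

lemma regularized_cost_measurable:
  fixes X :: "(real ^ 'd) set"
  assumes \<pi>\<^sub>0: "\<pi>\<^sub>0 \<in> policies X K" and \<pi>: "\<pi> \<in> policies X K"
    and h: "(\<lambda>(u, q, c). h u q c)
          \<in> borel_measurable (restrict_space borel ({0..1} \<times> {0..1} \<times> {-1..0}))"
  shows "regularized_cost h \<pi> \<pi>\<^sub>0
    \<in> borel_measurable (context_space X \<Otimes>\<^sub>M action_space K \<Otimes>\<^sub>M cost_space)"
proof -
  let ?B = "context_space X \<Otimes>\<^sub>M action_space K \<Otimes>\<^sub>M cost_space"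
  \<comment> \<open>The action is itself a coordinate of z, whereas
    \<open>policy_prob_measurable\<close> fixes it. As there are finitely many actions,
    measurability for each fixed one gives joint measurability.\<close>
  have prob: "(\<lambda>z. policy_prob \<rho> (fst (snd z)) (fst z)) \<in> borel_measurable ?B"
    if \<rho>: "\<rho> \<in> policies X K" for \<rho> :: "real ^ 'd \<Rightarrow> nat measure"
  proof (rule measurable_compose_countable'[where I="{1..K}"
        and f="\<lambda>a z. policy_prob \<rho> a (fst z)" and g="\<lambda>z. fst (snd z)"])
    show "(\<lambda>z. policy_prob \<rho> a (fst z)) \<in> borel_measurable ?B" if "a \<in> {1..K}" for a
      by (rule measurable_compose[OF measurable_fst policy_prob_measurable[OF \<rho> that]])
    show "(\<lambda>z. fst (snd z)) \<in> ?B \<rightarrow>\<^sub>M count_space {1..K}"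
      using measurable_compose[OF measurable_snd measurable_fst]
      by (simp add: action_space_def)
  qed simp
  have cost: "(\<lambda>z. snd (snd z)) \<in> borel_measurable ?B"
    by (rule measurable_compose[OF measurable_compose[OF measurable_snd measurable_snd]
          borel_measurable_cost_space])
  let ?uqc = "\<lambda>z. (policy_prob \<pi> (fst (snd z)) (fst z), policy_prob \<pi>\<^sub>0 (fst (snd z)) (fst z), snd (snd z))"
  have "?uqc \<in> borel_measurable ?B"
    by (intro borel_measurable_Pair prob[OF \<pi>] prob[OF \<pi>\<^sub>0] cost)
  \<comment> \<open>The function h is measurable only on the box, so the triple has to be shown to
    take its values there.\<close>
  then have "?uqc \<in> ?B \<rightarrow>\<^sub>M restrict_space borel ({0..1} \<times> {0..1} \<times> {-1..0})"
  proof (rule measurable_restrict_space2[rotated])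
    show "?uqc \<in> space ?B \<rightarrow> {0..1} \<times> {0..1} \<times> {-1..0}"
    proof
      fix z assume z: "z \<in> space ?B"
      then have "fst z \<in> X" and "snd (snd z) \<in> {-1..0}"
        by (auto simp: space_pair_measure)
      then show "?uqc z \<in> {0..1} \<times> {0..1} \<times> {-1..0}"
        using policy_prob_bounds[OF \<pi>] policy_prob_bounds[OF \<pi>\<^sub>0] by blast
    qed
  qed
  from measurable_compose[OF this h] show ?thesis
    by (simp add: regularized_cost_def case_prod_unfold)
qed

text \<open>The weight q that \<open>\<pi>\<^sub>0\<close> gives to an action cancels the
  denominator of \<open>u * c / q\<close>, which turns an average under \<open>\<pi>\<^sub>0\<close>
  into one under \<open>\<pi>\<close>. Equality can fail for two reasons: h may lie above its lower
  bound, and actions with q = 0 vanish on the left while still adding a nonnegative amount on the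
  right.\<close>

lemma nn_integral_regularized_cost_le:
  fixes X :: "(real ^ 'd) set"
  assumes \<nu>: "\<nu> \<in> space (prob_algebra (context_space X))"
    and p: "p \<in> cost_kernels X K"
    and \<pi>\<^sub>0: "\<pi>\<^sub>0 \<in> policies X K" and \<pi>: "\<pi> \<in> policies X K"
    and lam: "0 < lam"
    and h: "(\<lambda>(u, q, c). h u q c)
          \<in> borel_measurable (restrict_space borel ({0..1} \<times> {0..1} \<times> {-1..0}))"
    and h_lower: "\<And>u q c. u \<in> {0..1} \<Longrightarrow> q \<in> {0<..1} \<Longrightarrow> c \<in> {-1..0} \<Longrightarrow> u * c / q \<le> h u q c"
  shows "(\<integral>\<^sup>+z. ennreal (1 - lam * regularized_cost h \<pi> \<pi>\<^sub>0 z) \<partial>logged_tuple_dist X K \<nu> p \<pi>\<^sub>0)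
    \<le> ennreal (1 - lam * risk X K \<nu> p \<pi>)"
proof -
  interpret \<nu>: prob_space \<nu>
    using \<nu> by (simp add: space_prob_algebra)
  have sets_\<nu>: "sets \<nu> = sets (context_space X)"
    using \<nu> by (simp add: space_prob_algebra)
  have sp_\<nu>: "space \<nu> = X"
    using sets_eq_imp_space_eq[OF sets_\<nu>] by simp
  have p': "p \<in> (context_space X \<Otimes>\<^sub>M action_space K) \<rightarrow>\<^sub>M prob_algebra cost_space"
    using p by (simp add: cost_kernels_def)
  note [measurable] = regularized_cost_measurable[OF \<pi>\<^sub>0 \<pi> h]
  \<comment> \<open>The second factor is the weight that \<open>nn_integral_policy\<close> attaches
    to the action. If it is 0, the left side is 0 and the bound is immediate; otherwise
    \<open>h_lower\<close> applies, since then q is positive.\<close>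
  have weighted: "(\<integral>\<^sup>+c. ennreal (1 - lam * regularized_cost h \<pi> \<pi>\<^sub>0 (x, a, c)) \<partial>p (x, a))
        * ennreal (policy_prob \<pi>\<^sub>0 a x)
      \<le> ennreal (policy_prob \<pi>\<^sub>0 a x + lam * (- mean_cost p x a * policy_prob \<pi> a x))"
    if x: "x \<in> X" and a: "a \<in> {1..K}" for x a
  proof (cases "policy_prob \<pi>\<^sub>0 a x = 0")
    case False
    define q where "q = policy_prob \<pi>\<^sub>0 a x"
    define u where "u = policy_prob \<pi> a x"
    have q: "q \<in> {0<..1}" and u: "u \<in> {0..1}"
      using False policy_prob_bounds[OF \<pi>\<^sub>0 x, of a] policy_prob_bounds[OF \<pi> x, of a]
      by (auto simp: q_def u_def)
    have xa: "(x, a) \<in> space (context_space X \<Otimes>\<^sub>M action_space K)"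
      using x a by (simp add: space_pair_measure)
    interpret prob_space "p (x, a)"
      by (rule kernel_prob_space(1)[OF p' xa])
    have sp: "space (p (x, a)) = {-1..0}"
      using kernel_prob_space(3)[OF p' xa] by simp
    note int = integrable_cost[OF p x a]
    have "(\<integral>\<^sup>+c. ennreal (1 - lam * regularized_cost h \<pi> \<pi>\<^sub>0 (x, a, c)) \<partial>p (x, a))
        \<le> (\<integral>\<^sup>+c. ennreal (1 - lam * (u / q) * c) \<partial>p (x, a))"
    proof (intro nn_integral_mono ennreal_leI)
      fix c assume "c \<in> space (p (x, a))"
      then have "u * c / q \<le> h u q c"
        using h_lower u q by (simp add: sp)
      then have "lam * (u * c / q) \<le> lam * h u q c"
        using lam by (intro mult_left_mono) auto
      then show "1 - lam * regularized_cost h \<pi> \<pi>\<^sub>0 (x, a, c) \<le> 1 - lam * (u / q) * c"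
        by (simp add: regularized_cost_def u_def q_def)
    qed
    \<comment> \<open>The dominating integrand is affine in c and nonnegative, so its integral is an
      ordinary one, and linearity brings in the mean cost.\<close>
    also have "\<dots> = ennreal (\<integral>c. 1 - lam * (u / q) * c \<partial>p (x, a))"
    proof (intro nn_integral_eq_integral AE_I2)
      show "integrable (p (x, a)) (\<lambda>c. 1 - lam * (u / q) * c)"
        using int by simp
      fix c assume "c \<in> space (p (x, a))"
      then have "lam * (u / q) * c \<le> 0"
        using u q lam by (intro mult_nonneg_nonpos) (auto simp: sp)
      then show "0 \<le> 1 - lam * (u / q) * c" by simp
    qed
    also have "(\<integral>c. 1 - lam * (u / q) * c \<partial>p (x, a)) = 1 - lam * (u / q) * mean_cost p x a"
      using int prob_space by (simp add: mean_cost_def)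
    finally have "(\<integral>\<^sup>+c. ennreal (1 - lam * regularized_cost h \<pi> \<pi>\<^sub>0 (x, a, c)) \<partial>p (x, a)) * ennreal q
        \<le> ennreal (1 - lam * (u / q) * mean_cost p x a) * ennreal q"
      by (rule mult_right_mono) simp
    also have "\<dots> = ennreal ((1 - lam * (u / q) * mean_cost p x a) * q)"
      using q by (simp add: ennreal_mult'')
    also have "(1 - lam * (u / q) * mean_cost p x a) * q = q + lam * (- mean_cost p x a * u)"
      using q by (simp add: field_simps)
    finally show ?thesis by (simp add: q_def u_def)
  qed simp
  have cost_nonneg: "0 \<le> - mean_cost p x a * policy_prob \<pi> a x" if "x \<in> X" "a \<in> {1..K}" for x a
    using mean_cost_bounds[OF p that] policy_prob_bounds[OF \<pi> that(1), of a]
    by (intro mult_nonneg_nonneg) auto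
  have at_context: "(\<integral>\<^sup>+a. \<integral>\<^sup>+c. ennreal (1 - lam * regularized_cost h \<pi> \<pi>\<^sub>0 (x, a, c)) \<partial>p (x, a) \<partial>\<pi>\<^sub>0 x)
      \<le> 1 + ennreal lam * (\<integral>\<^sup>+a. ennreal (- mean_cost p x a) \<partial>\<pi> x)" if x: "x \<in> X" for x
  proof -
    have "(\<integral>\<^sup>+a. \<integral>\<^sup>+c. ennreal (1 - lam * regularized_cost h \<pi> \<pi>\<^sub>0 (x, a, c)) \<partial>p (x, a) \<partial>\<pi>\<^sub>0 x)
      \<le> (\<Sum>a=1..K. ennreal (policy_prob \<pi>\<^sub>0 a x + lam * (- mean_cost p x a * policy_prob \<pi> a x)))"
      unfolding nn_integral_policy[OF \<pi>\<^sub>0 x] by (intro sum_mono weighted x)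
    also have "\<dots> = ennreal (\<Sum>a=1..K. policy_prob \<pi>\<^sub>0 a x + lam * (- mean_cost p x a * policy_prob \<pi> a x))"
      using policy_prob_bounds[OF \<pi>\<^sub>0 x] lam cost_nonneg[OF x]
      by (intro sum_ennreal add_nonneg_nonneg mult_nonneg_nonneg[of lam]) auto
    also have "\<dots> = ennreal (1 + lam * (\<Sum>a=1..K. - mean_cost p x a * policy_prob \<pi> a x))"
      by (simp only: sum.distrib sum_policy_prob[OF \<pi>\<^sub>0 x] sum_distrib_left)
    \<comment> \<open>Splitting a sum under \<open>ennreal\<close> needs nonnegative summands, which
      \<open>cost_nonneg\<close> supplies.\<close>
    also have "\<dots> = 1 + ennreal lam * ennreal (\<Sum>a=1..K. - mean_cost p x a * policy_prob \<pi> a x)"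
      using lam by (subst ennreal_plus)
        (auto simp: ennreal_mult' simp del: ennreal_plus intro!: mult_nonneg_nonneg sum_nonneg cost_nonneg[OF x, simplified])
    also have "ennreal (\<Sum>a=1..K. - mean_cost p x a * policy_prob \<pi> a x)
        = (\<Sum>a=1..K. ennreal (- mean_cost p x a * policy_prob \<pi> a x))"
      by (intro sum_ennreal[symmetric] cost_nonneg x)
    also have "\<dots> = (\<Sum>a=1..K. ennreal (- mean_cost p x a) * ennreal (policy_prob \<pi> a x))"
      using policy_prob_bounds[OF \<pi> x] by (intro sum.cong refl ennreal_mult'') auto
    also have "\<dots> = (\<integral>\<^sup>+a. ennreal (- mean_cost p x a) \<partial>\<pi> x)"
      by (rule nn_integral_policy[OF \<pi> x, symmetric])
    finally show ?thesis .
  qed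
  \<comment> \<open>Needed to split the outer integral over contexts by linearity.\<close>
  have [measurable]: "(\<lambda>x. \<integral>\<^sup>+a. ennreal (- mean_cost p x a) \<partial>\<pi> x) \<in> borel_measurable \<nu>"
  proof -
    have "(\<lambda>x. \<integral>\<^sup>+a. ennreal (- mean_cost p x a) \<partial>\<pi> x) \<in> borel_measurable (context_space X)"
    proof (rule nn_integral_measurable_subprob_algebra2)
      show "\<pi> \<in> context_space X \<rightarrow>\<^sub>M subprob_algebra (action_space K)"
        using \<pi> by (simp add: policies_def measurable_prob_algebraD)
      show "(\<lambda>(x, a). ennreal (- mean_cost p x a)) \<in> borel_measurable (context_space X \<Otimes>\<^sub>M action_space K)"
        using mean_cost_measurable[OF p] by (simp add: case_prod_unfold)
    qed
    then show ?thesis using sets_\<nu> by (simp cong: measurable_cong_sets)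
  qed
  have "(\<integral>\<^sup>+z. ennreal (1 - lam * regularized_cost h \<pi> \<pi>\<^sub>0 z) \<partial>logged_tuple_dist X K \<nu> p \<pi>\<^sub>0)
      = (\<integral>\<^sup>+x. \<integral>\<^sup>+a. \<integral>\<^sup>+c. ennreal (1 - lam * regularized_cost h \<pi> \<pi>\<^sub>0 (x, a, c)) \<partial>p (x, a) \<partial>\<pi>\<^sub>0 x \<partial>\<nu>)"
    by (rule nn_integral_logged_tuple_dist[OF \<nu> p \<pi>\<^sub>0]) simp
  also have "\<dots> \<le> (\<integral>\<^sup>+x. 1 + ennreal lam * (\<integral>\<^sup>+a. ennreal (- mean_cost p x a) \<partial>\<pi> x) \<partial>\<nu>)"
    by (intro nn_integral_mono at_context) (simp add: sp_\<nu>)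
  also have "\<dots> = 1 + ennreal lam * ennreal (- risk X K \<nu> p \<pi>)"
    by (simp add: nn_integral_add nn_integral_cmult \<nu>.emeasure_space_1 nn_integral_mean_cost_eq_risk[OF \<nu> p \<pi>])
  also have "\<dots> = ennreal (1 - lam * risk X K \<nu> p \<pi>)"
    using lam risk_nonpos[OF \<nu> p \<pi>]
    by (simp add: mult_nonneg_nonpos flip: ennreal_mult' ennreal_1 ennreal_plus)
  finally show ?thesis .
qed

section \<open>Inverting psi and concluding\<close>

text \<open>The function \<open>psi lam\<close> is increasing with all values below
  \<open>1 / lam\<close>. The condition \<open>0 < 1 - lam * r\<close> places r below
  \<open>1 / lam\<close>, so logarithms may be taken to solve for the argument.\<close>

lemma le_psi_iff:
  assumes "0 < lam" and "0 < 1 - lam * r"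
  shows "r \<le> psi lam y \<longleftrightarrow> - lam * y \<le> ln (1 - lam * r)"
proof -
  have "r \<le> psi lam y \<longleftrightarrow> exp (- lam * y) \<le> 1 - lam * r"
    using assms(1) by (auto simp: psi_def field_simps)
  also have "\<dots> \<longleftrightarrow> - lam * y \<le> ln (1 - lam * r)"
    using assms(2) by (simp add: ln_ge_iff)
  finally show ?thesis .
qed

text \<open>The range \<open>q \<in> {0<..1}\<close> in \<open>h_lower\<close> matters: at
  \<open>q = 0\<close> the convention \<open>x / 0 = 0\<close> would turn the bound into
  \<open>0 \<le> h u 0 c\<close>, which together with \<open>h_nonpos\<close> would force
  \<open>h u 0 c = 0\<close>.\<close>

theorem corollary5:
  fixes X :: "(real ^ 'd) set" and K n :: nat
    and \<nu> :: "(real ^ 'd) measure"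
    and p :: "(real ^ 'd) \<times> nat \<Rightarrow> real measure"
    and \<pi> \<pi>\<^sub>0 :: "real ^ 'd \<Rightarrow> nat measure"
    and h :: "real \<Rightarrow> real \<Rightarrow> real \<Rightarrow> real"
    and \<delta> lam :: real
  assumes "compact X"
    and "\<nu> \<in> space (prob_algebra (context_space X))"
    and "p \<in> cost_kernels X K"
    and "\<pi>\<^sub>0 \<in> policies X K"
    and "\<pi> \<in> policies X K"
    and "n \<ge> 1"
    and "0 < \<delta>" and "\<delta> \<le> 1"
    and "lam > 0"
    and h_measurable: "(\<lambda>(u, q, c). h u q c)
          \<in> borel_measurable (restrict_space borel ({0..1} \<times> {0..1} \<times> {-1..0}))"
    and h_nonpos: "\<And>u q c. u \<in> {0..1} \<Longrightarrow> q \<in> {0..1} \<Longrightarrow> c \<in> {-1..0} \<Longrightarrow> h u q c \<le> 0"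
    and h_lower: "\<And>u q c. u \<in> {0..1} \<Longrightarrow> q \<in> {0<..1} \<Longrightarrow> c \<in> {-1..0} \<Longrightarrow> u * c / q \<le> h u q c"
  shows "measure (logged_data_dist X K \<nu> p \<pi>\<^sub>0 n)
           {D \<in> space (logged_data_dist X K \<nu> p \<pi>\<^sub>0 n).
              risk X K \<nu> p \<pi>
                \<le> psi lam (- (1 / real n) * (\<Sum>i=1..n. (1 / lam) * ln (1 - lam * regularized_cost h \<pi> \<pi>\<^sub>0 (D i)))
                         + ln (1 / \<delta>) / (lam * real n))}
         \<ge> 1 - \<delta>"
proof -
  let ?M = "logged_tuple_dist X K \<nu> p \<pi>\<^sub>0"
  let ?B = "context_space X \<Otimes>\<^sub>M action_space K \<Otimes>\<^sub>M cost_space"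
  let ?L = "logged_data_dist X K \<nu> p \<pi>\<^sub>0 n"
  let ?R = "risk X K \<nu> p \<pi>"
  define Y where "Y z = 1 - lam * regularized_cost h \<pi> \<pi>\<^sub>0 z" for z
  define m where "m = 1 - lam * ?R"
  note model = assms(2,3,4)
  have M: "?M \<in> space (prob_algebra ?B)"
    by (rule logged_tuple_dist[OF model])
  interpret prob_space ?M
    using M by (simp add: space_prob_algebra)
  have sets_M: "sets ?M = sets ?B"
    using M by (simp add: space_prob_algebra)
  have sp_M: "space ?M = X \<times> {1..K} \<times> {-1..0}"
    using sets_eq_imp_space_eq[OF sets_M] by (simp add: space_pair_measure)
  have L: "?L = (\<Pi>\<^sub>M i\<in>{1..n}. ?M)"
    by (simp add: logged_data_dist_def)
  interpret L: prob_space ?L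
    unfolding L by (intro prob_space_PiM prob_space_axioms)
  have [measurable]: "regularized_cost h \<pi> \<pi>\<^sub>0 \<in> borel_measurable ?M"
    using regularized_cost_measurable[OF assms(4,5) h_measurable] sets_M
    by (simp cong: measurable_cong_sets)
  have Y_meas: "Y \<in> borel_measurable ?M"
    unfolding Y_def by measurable
  \<comment> \<open>Serves twice: nonnegativity for the Markov step, and strict positivity for the
    logarithms.\<close>
  have Y_ge: "1 \<le> Y z" if "z \<in> space ?M" for z
  proof -
    have "regularized_cost h \<pi> \<pi>\<^sub>0 z \<le> 0"
      using that policy_prob_bounds[OF assms(4)] policy_prob_bounds[OF assms(5)]
      by (auto simp: sp_M regularized_cost_def intro!: h_nonpos)
    then show ?thesis
      using \<open>lam > 0\<close> by (simp add: Y_def mult_nonneg_nonpos)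
  qed
  have "1 \<le> m"
    using risk_nonpos[OF assms(2,3,5)] \<open>lam > 0\<close> by (simp add: m_def mult_nonneg_nonpos)
  have mean: "(\<integral>\<^sup>+z. ennreal (Y z) \<partial>?M) \<le> ennreal m"
    unfolding Y_def m_def
    by (rule nn_integral_regularized_cost_le[OF assms(2-5) \<open>lam > 0\<close> h_measurable h_lower])
  have "1 - \<delta> \<le> measure ?L {D \<in> space ?L. (\<Prod>i=1..n. Y (D i)) \<le> m ^ n / \<delta>}"
    using measure_PiM_prod_le[of "{1..n}", OF _ Y_meas order_trans[OF zero_le_one Y_ge] mean]
      \<open>1 \<le> m\<close> \<open>0 < \<delta>\<close> by (simp add: L)
  also have "\<dots> \<le> measure ?L {D \<in> space ?L. ?R \<le> psi lam (- (1 / real n)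
        * (\<Sum>i=1..n. (1 / lam) * ln (1 - lam * regularized_cost h \<pi> \<pi>\<^sub>0 (D i)))
      + ln (1 / \<delta>) / (lam * real n))}"
  proof (intro L.finite_measure_mono Collect_mono impI conjI)
    \<comment> \<open>Monotonicity of the measure requires the larger event to be measurable; a
      nonmeasurable set would have measure 0 by convention.\<close>
    show "{D \<in> space ?L. ?R \<le> psi lam (- (1 / real n)
        * (\<Sum>i=1..n. (1 / lam) * ln (1 - lam * regularized_cost h \<pi> \<pi>\<^sub>0 (D i)))
      + ln (1 / \<delta>) / (lam * real n))} \<in> L.events"
      unfolding L psi_def by measurable
    fix D assume "D \<in> space ?L \<and> (\<Prod>i=1..n. Y (D i)) \<le> m ^ n / \<delta>"
    then have D: "D \<in> space ?L" and le: "(\<Prod>i=1..n. Y (D i)) \<le> m ^ n / \<delta>" by auto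
    show "D \<in> space ?L" by (rule D)
    have Y_pos: "0 < Y (D i)" if "i \<in> {1..n}" for i
      using D that by (intro less_le_trans[OF zero_less_one Y_ge]) (auto simp: L space_PiM PiE_mem)
    have "(\<Sum>i=1..n. ln (Y (D i))) = ln (\<Prod>i=1..n. Y (D i))"
      by (intro ln_prod[symmetric] less_imp_neq[OF Y_pos, symmetric]) simp_all
    also have "\<dots> \<le> ln (m ^ n / \<delta>)"
      by (intro ln_mono le prod_pos Y_pos)
    also have "\<dots> = real n * ln m + ln (1 / \<delta>)"
      using \<open>1 \<le> m\<close> \<open>0 < \<delta>\<close> by (simp add: ln_div ln_realpow)
    finally have "(\<Sum>i=1..n. ln (Y (D i))) \<le> real n * ln m + ln (1 / \<delta>)" .
    then have "((\<Sum>i=1..n. ln (Y (D i))) - ln (1 / \<delta>)) / real n \<le> ln m"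
      using \<open>n \<ge> 1\<close> by (simp add: pos_divide_le_eq mult.commute)
    \<comment> \<open>The left side is rewritten as \<open>- lam\<close> times the argument of
      \<open>psi\<close> in the claim, the shape that \<open>le_psi_iff\<close> expects; its
      positivity condition follows from \<open>1 \<le> m\<close>.\<close>
    also have "((\<Sum>i=1..n. ln (Y (D i))) - ln (1 / \<delta>)) / real n
        = - lam * (- (1 / real n) * (\<Sum>i=1..n. (1 / lam) * ln (Y (D i))) + ln (1 / \<delta>) / (lam * real n))"
      using \<open>n \<ge> 1\<close> \<open>lam > 0\<close> unfolding sum_distrib_left[symmetric] by (simp add: field_simps)
    finally show "?R \<le> psi lam (- (1 / real n)
        * (\<Sum>i=1..n. (1 / lam) * ln (1 - lam * regularized_cost h \<pi> \<pi>\<^sub>0 (D i)))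
      + ln (1 / \<delta>) / (lam * real n))"
      using \<open>lam > 0\<close> \<open>1 \<le> m\<close> by (subst le_psi_iff) (auto simp: m_def Y_def)
  qed
  finally show ?thesis .
qed

end
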